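(* There exists a finitely generated group $H$ of intermediate growth that contains as a subgroup the group $\mathfrak S_\infty$ of finitely supported permutations of an infinite countable set. Moreover, $H$ can be chosen so that its growth function satisfies $\exp(n^\alpha)\preceq v_H(n)\preceq\exp(\log(n)\,n^\alpha)$.
   Context: Let $\eta$ be the real root of $t^3+t^2+t-2$ and $\alpha=\log2/\log(2/\eta)\approx0.7674$. A finitely generated group has intermediate growth if its growth function is neither bounded above by a polynomial nor $\sim\exp(n)$. Growth functions are counted with respect to finite generating sets; $g\preceq f$ if $g(n)\le f(Cn)$ for some $C>0$ and all large $n$. *)

theory Defs
  imports "HOL-Algebra.Algebra" "HOL-Analysis.Analysis"
begin

fun word_ball :: "('a, 'b) monoid_scheme \<Rightarrow> 'a set \<Rightarrow> nat \<Rightarrow> 'a set" where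
  "word_ball G S 0 = {\<one>\<^bsub>G\<^esub>}"
| "word_ball G S (Suc n) = word_ball G S n \<union>
     {x \<otimes>\<^bsub>G\<^esub> s | x s. x \<in> word_ball G S n \<and> (s \<in> S \<or> s \<in> (m_inv G) ` S)}"

definition growth_fun :: "('a, 'b) monoid_scheme \<Rightarrow> 'a set \<Rightarrow> nat \<Rightarrow> real" where
  "growth_fun G S n = real (card (word_ball G S n))"

definition growth_le :: "(nat \<Rightarrow> real) \<Rightarrow> (nat \<Rightarrow> real) \<Rightarrow> bool" (infix "\<preceq>\<^sub>g" 50) where
  "g \<preceq>\<^sub>g f \<longleftrightarrow> (\<exists>C::nat. C > 0 \<and> (\<forall>\<^sub>F n in sequentially. g n \<le> f (C * n)))"

definition growth_equiv :: "(nat \<Rightarrow> real) \<Rightarrow> (nat \<Rightarrow> real) \<Rightarrow> bool" (infix "\<sim>\<^sub>g" 50) where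
  "g \<sim>\<^sub>g f \<longleftrightarrow> g \<preceq>\<^sub>g f \<and> f \<preceq>\<^sub>g g"

definition intermediate_growth :: "(nat \<Rightarrow> real) \<Rightarrow> bool" where
  "intermediate_growth v \<longleftrightarrow>
     \<not> (\<exists>d::nat. v \<preceq>\<^sub>g (\<lambda>n. real n ^ d)) \<and> \<not> (v \<sim>\<^sub>g (\<lambda>n. exp (real n)))"

definition FSym :: "(nat \<Rightarrow> nat) monoid" where
  "FSym = \<lparr>carrier = {f. bij f \<and> finite {x. f x \<noteq> x}}, monoid.mult = (\<circ>), one = id\<rparr>"

definition eta :: real where
  "eta = (THE t. t^3 + t^2 + t - 2 = 0)"

definition alpha :: real where
  "alpha = ln 2 / ln (2 / eta)"

end

theory Submission
  imports Defs "HOL-Real_Asymp.Real_Asymp"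
begin

text \<open>Let the first Grigorchuk group \<open>G\<close> act on the orbit \<open>X\<close> of the ray \<open>1\<^sup>\<infinity>\<close>, add a fixed point \<open>\<infinity>\<close>,
  and let \<open>H\<close> be generated by \<open>G\<close> and the transposition \<open>\<tau>\<close> of \<open>1\<^sup>\<infinity>\<close> and \<open>\<infinity>\<close>. The conjugates of \<open>\<tau>\<close>
  include all transpositions of a point of \<open>X\<close> with \<open>\<infinity>\<close>, so \<open>H\<close> contains the finitary permutations
  of \<open>X\<close>. An element of length \<open>n\<close> is a product of an element of \<open>G\<close> and a permutation supported on
  \<open>\<infinity>\<close> and the inverted orbit of a word \<open>w\<close> of length at most \<open>n\<close>, that is the set of images of
  \<open>1\<^sup>\<infinity>\<close> under the prefixes of \<open>w\<close>.

  In Bartholdi's weights the two sections of \<open>w\<close> have total weight at most \<open>eta\<close> times that of \<open>w\<close>, up to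
  a constant, and the inverted orbit of \<open>w\<close> splits into those of the sections. By concavity of
  \<open>x powr alpha\<close> and \<open>2 * (eta / 2) powr alpha = 1\<close>, iterating the decomposition until the weight is bounded
  gives a tree with \<open>O(n powr alpha)\<close> leaves. The tree determines both the element of \<open>G\<close> and a set of
  \<open>O(n powr alpha)\<close> points containing the inverted orbit, whose permutations account for the logarithm.

  Conversely a substitution doubles inverted orbits while multiplying weights by \<open>2 / eta\<close>, and
  inserting or omitting \<open>\<tau>\<close> at each newly visited point of an inverted orbit of size \<open>m\<close> yields \<open>2 ^ m\<close>
  distinct elements.\<close>

section \<open>Words in the Grigorchuk group and their sections\<close>

text \<open>The first Grigorchuk group acts on the orbit of the ray \<open>1\<^sup>\<infinity>\<close>, here encoded as \<^typ>\<open>nat\<close>: the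
  binary digits of \<open>n\<close> mark the positions where a ray differs from \<open>1\<^sup>\<infinity>\<close>, so \<open>1\<^sup>\<infinity>\<close> is \<open>0\<close>.\<close>

datatype klein = kI | kB | kC | kD

fun kmul :: "klein \<Rightarrow> klein \<Rightarrow> klein" where
  "kmul kI y = y"
| "kmul x kI = x"
| "kmul kB kB = kI" | "kmul kB kC = kD" | "kmul kB kD = kC"
| "kmul kC kB = kD" | "kmul kC kC = kI" | "kmul kC kD = kB"
| "kmul kD kB = kC" | "kmul kD kC = kB" | "kmul kD kD = kI"

text \<open>The wreath recursion b = (a, c), c = (a, d), d = (1, b): \<open>rot\<close> gives the
  section on even numbers, and \<open>flag\<close> tells whether the section on odd numbers is
  a.\<close>

fun rot :: "klein \<Rightarrow> klein" where
  "rot kI = kI" | "rot kB = kC" | "rot kC = kD" | "rot kD = kB"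

definition flag :: "klein \<Rightarrow> bool" where
  "flag x \<longleftrightarrow> x = kB \<or> x = kC"

definition flip :: "nat \<Rightarrow> nat" where
  "flip m = (if even m then m + 1 else m - 1)"

text \<open>Zero is even and its own half, so the recursion needs it as a base case; the ray it
  encodes is fixed by b, c and d.\<close>

fun kact :: "klein \<Rightarrow> nat \<Rightarrow> nat" where
  "kact x m = (if m = 0 then 0
     else if even m then 2 * kact (rot x) (m div 2)
     else if flag x then 2 * flip (m div 2) + 1 else m)"

declare kact.simps [simp del]

lemma flip_double [simp]: "flip (2 * m) = Suc (2 * m)" "flip (Suc (2 * m)) = 2 * m"
  by (auto simp: flip_def)

lemma flip_flip [simp]: "flip (flip m) = m"
  by (auto simp: flip_def)

lemma kact_0 [simp]: "kact x 0 = 0"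
  by (simp add: kact.simps)

lemma kact_even [simp]: "kact x (2 * m) = 2 * kact (rot x) m"
  by (cases "m = 0") (auto simp: kact.simps[of x "2 * m"])

lemma kact_odd [simp]: "kact x (Suc (2 * m)) = Suc (2 * (if flag x then flip m else m))"
  by (auto simp: kact.simps[of x "Suc (2 * m)"])

lemma double_induct [case_names zero even odd]:
  fixes m :: nat
  assumes "P 0" "\<And>m. P m \<Longrightarrow> P (2 * m)" "\<And>m. P m \<Longrightarrow> P (Suc (2 * m))"
  shows "P m"
proof (induction m rule: less_induct)
  case (less m)
  show ?case
  proof (cases "m = 0")
    case False
    then have "P (m div 2)" using less by simp
    then show ?thesis using assms(2,3)[of "m div 2"] by (cases "even m") auto
  qed (use assms in simp)
qed

lemma rot_kmul: "rot (kmul x y) = kmul (rot x) (rot y)"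
  by (cases x; cases y) auto

lemma flag_kmul: "flag (kmul x y) \<longleftrightarrow> flag x \<noteq> flag y"
  by (cases x; cases y) (auto simp: flag_def)

lemma kact_kmul: "kact (kmul x y) m = kact x (kact y m)"
  by (induction m arbitrary: x y rule: double_induct) (auto simp: rot_kmul flag_kmul)

lemma kact_kI [simp]: "kact kI = id"
proof
  fix m show "kact kI m = id m"
    by (induction m rule: double_induct) (auto simp: flag_def)
qed

lemma kmul_self [simp]: "kmul x x = kI"
  by (cases x) auto

lemma kact_kact [simp]: "kact x (kact x m) = m"
  using kact_kmul[of x x m] by simp

text \<open>The word \<open>Step x\<^sub>0 (Step x\<^sub>1 (\<dots> (End x\<^sub>k)))\<close> stands for \<open>x\<^sub>0 a x\<^sub>1 a \<dots> a x\<^sub>k\<close>.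
  Factors \<open>aa\<close> are never cancelled, since cancelling them would change the inverted orbit.\<close>

datatype word = End klein | Step klein word

primrec wact :: "word \<Rightarrow> nat \<Rightarrow> nat" where
  "wact (End x) = kact x"
| "wact (Step x w) = kact x \<circ> flip \<circ> wact w"

primrec orb :: "word \<Rightarrow> nat set" where
  "orb (End x) = {0}"
| "orb (Step x w) = insert 0 ((kact x \<circ> flip) ` orb w)"

primrec len :: "word \<Rightarrow> nat" where
  "len (End x) = 0"
| "len (Step x w) = Suc (len w)"

primrec parity :: "word \<Rightarrow> bool" where
  "parity (End x) = False"
| "parity (Step x w) = (\<not> parity w)"

primrec lmul :: "klein \<Rightarrow> word \<Rightarrow> word" where
  "lmul z (End x) = End (kmul z x)"
| "lmul z (Step x w) = Step (kmul z x) w"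

text \<open>\<open>sec e w\<close> is the section of \<open>w\<close> that produces the numbers of parity \<open>e\<close>. Indexing by the
  parity of the value and not of the argument turns prefixes of \<open>w\<close> into prefixes of \<open>sec e w\<close>.\<close>

primrec sec :: "bool \<Rightarrow> word \<Rightarrow> word" where
  "sec e (End x) = (if \<not> e then End (rot x) else if flag x then Step kI (End kI) else End kI)"
| "sec e (Step x w) = (if \<not> e then lmul (rot x) (sec True w)
     else if flag x then Step kI (sec False w) else sec False w)"

lemma wact_lmul [simp]: "wact (lmul z w) = kact z \<circ> wact w"
  by (cases w) (auto simp: kact_kmul)

lemma orb_lmul [simp]: "orb (lmul z w) = kact z ` orb w"
  by (cases w) (auto simp: kact_kmul image_comp)

lemma len_lmul [simp]: "len (lmul z w) = len w"
  by (cases w) auto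

lemma zero_in_orb [simp]: "0 \<in> orb w"
  by (cases w) auto

lemma finite_orb [simp]: "finite (orb w)"
  by (induction w) auto

definition glue :: "bool \<Rightarrow> nat \<Rightarrow> nat" where
  "glue e m = (if e then Suc (2 * m) else 2 * m)"

lemma glue_surj: "\<exists>e m. n = glue e m"
  by (rule exI[of _ "odd n"], rule exI[of _ "n div 2"]) (auto simp: glue_def)

lemma flip_glue [simp]: "flip (glue e m) = glue (\<not> e) m"
  by (auto simp: glue_def)

lemma kact_glue: "kact x (glue e m) = glue e (if e then (if flag x then flip m else m) else kact (rot x) m)"
  by (auto simp: glue_def)

text \<open>Letters preserve parity and \<open>flip\<close> reverses it, so the value has the parity
  of the argument, reversed if \<open>parity w\<close>.\<close>

lemma wact_glue: "wact w (glue e m) = glue (e \<noteq> parity w) (wact (sec (e \<noteq> parity w) w) m)"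
proof (induction w arbitrary: e m)
  case (End x)
  then show ?case by (auto simp: glue_def)
next
  case (Step x w)
  show ?case by (cases "e \<noteq> parity w") (auto simp: Step.IH kact_glue)
qed

text \<open>Prefixes of \<open>w\<close> sending 0 to an even or odd number induce prefixes of the
  corresponding section. The inclusion can be strict, since the terminal letters of the sections may
  add points.\<close>

lemma orb_sec: "orb w \<subseteq> glue False ` orb (sec False w) \<union> glue True ` orb (sec True w)"
proof (induction w)
  case (End x)
  then show ?case by (auto simp: glue_def)
next
  case (Step x w)
  show ?case
  proof
    fix n assume "n \<in> orb (Step x w)"
    then consider "n = 0" | y where "y \<in> orb w" "n = kact x (flip y)" by auto
    then show "n \<in> glue False ` orb (sec False (Step x w)) \<union> glue True ` orb (sec True (Step x w))"
    proof cases
      case 1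
      then have "n = glue False 0" by (simp add: glue_def)
      then show ?thesis using zero_in_orb by blast
    next
      case (2 y)
      then obtain e q where "q \<in> orb (sec e w)" "y = glue e q"
        using Step.IH by blast
      then show ?thesis using 2 by (cases e) (auto simp: kact_glue)
    qed
  qed
qed

text \<open>The induction is joint because a step exchanges the two sections and can lengthen only
  the one for odd values.\<close>

lemma len_sec: "len (sec True w) \<le> len w div 2 + 1 \<and> len (sec False w) \<le> (len w + 1) div 2"
  by (induction w) auto

section \<open>Contraction of the weight\<close>

lemma eta_root: "\<exists>!t::real. t^3 + t^2 + t - 2 = 0"
  and eta_bounds: "0 < eta" "eta < 1"
proof -
  let ?f = "\<lambda>t::real. t^3 + t^2 + t - 2"
  have "\<exists>t\<ge>0. t \<le> 1 \<and> ?f t = 0"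
    by (rule IVT') (auto intro!: continuous_intros)
  then obtain t where t: "0 \<le> t" "t \<le> 1" "?f t = 0" by blast
  have uniq: "s = t" if "?f s = 0" for s
  proof -
    \<comment> \<open>The difference of the cubic at \<open>s\<close> and \<open>t\<close>,
      factored. Twice the cofactor is a sum of squares, the last one positive because
      \<open>t\<close> is nonnegative.\<close>
    have "(s - t) * (s^2 + s * t + t^2 + s + t + 1) = 0"
      using that t(3) by (simp add: algebra_simps power2_eq_square power3_eq_cube)
    moreover have "2 * (s^2 + s * t + t^2 + s + t + 1) = (s + t)^2 + (s + 1)^2 + (t + 1)^2"
      by (simp add: algebra_simps power2_eq_square)
    moreover have "(s + t)^2 + (s + 1)^2 + (t + 1)^2 > 0"
      using t by (intro add_nonneg_pos) auto
    ultimately show ?thesis by auto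
  qed
  show *: "\<exists>!t::real. t^3 + t^2 + t - 2 = 0"
    using t uniq by blast
  have "eta = t" unfolding eta_def using t(3) by (rule the_equality) (rule uniq)
  moreover have "t \<noteq> 0" "t \<noteq> 1" using t(3) by auto
  ultimately show "0 < eta" "eta < 1" using t by auto
qed

lemma eta_cubic: "eta^3 = 2 - eta - eta^2"
  using theI'[OF eta_root] unfolding eta_def by linarith

lemma eta_powers: "eta^2 < eta" "eta^3 < eta^2" "0 < eta^3"
  using eta_bounds by (auto simp: power2_eq_square power3_eq_cube)

lemma alpha_bounds: "0 < alpha" "alpha < 1"
proof -
  have "ln 2 < ln (2 / eta)"
    using eta_bounds by (subst ln_less_cancel_iff) (auto simp: field_simps)
  moreover from this have "0 < ln (2 / eta)"
    using ln_gt_zero[of "2::real"] by linarith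
  ultimately show "0 < alpha" "alpha < 1"
    unfolding alpha_def by (auto intro!: divide_pos_pos simp: divide_less_eq_1)
qed

lemma two_over_eta_powr: "(2 / eta) powr alpha = 2"
proof -
  have "ln (2 / eta) > 0" using eta_bounds by (simp add: field_simps)
  then show ?thesis using eta_bounds unfolding alpha_def powr_def by auto
qed

text \<open>Bartholdi's weights: with \<open>anorm\<close> added, b, c and d weigh 1,
  \<open>eta\<close> and \<open>eta^2\<close>, a geometric progression that passing to sections
  shifts by one place.\<close>

fun knorm :: "klein \<Rightarrow> real" where
  "knorm kI = 0" | "knorm kB = eta^3" | "knorm kC = 1 - eta^2" | "knorm kD = 1 - eta"

definition anorm :: real where
  "anorm = 1 - eta^3"

text \<open>The terminal letter is charged an extra \<^term>\<open>anorm\<close>, so that the weight is a sum of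
  contributions of equal form.\<close>

primrec weight :: "word \<Rightarrow> real" where
  "weight (End x) = knorm x + anorm"
| "weight (Step x w) = knorm x + anorm + weight w"

lemma anorm_pos: "0 < anorm"
  unfolding anorm_def using eta_bounds eta_powers by linarith

lemma knorm_nonneg: "0 \<le> knorm x"
  using eta_bounds eta_powers by (cases x) (auto intro: less_imp_le)

text \<open>This triangle inequality pays for the letters merged by \<open>lmul\<close>; by the
  cubic equation it is sharp for c times d.\<close>

lemma knorm_kmul: "knorm (kmul x y) \<le> knorm x + knorm y"
  using eta_bounds eta_powers eta_cubic by (cases x; cases y) (auto; linarith)+

text \<open>The left side is what one letter contributes to both sections together. For b, c and d
  the cubic equation makes this an equality.\<close>

lemma knorm_sec: "knorm (rot x) + (if flag x then anorm else 0) \<le> eta * (knorm x + anorm)"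
proof -
  have "eta^4 = eta * (2 - eta - eta^2)"
    using eta_cubic by (simp add: power4_eq_xxxx power3_eq_cube)
  then have "eta^4 = 2 * eta - eta^2 - eta^3"
    by (simp add: algebra_simps power2_eq_square power3_eq_cube)
  moreover have "eta * eta^3 = eta^4" "eta * eta^2 = eta^3" "eta * eta = eta^2"
    by (simp_all add: power2_eq_square power3_eq_cube power4_eq_xxxx)
  ultimately show ?thesis
    using eta_cubic eta_bounds eta_powers mult_pos_pos[OF eta_bounds(1) anorm_pos]
    by (cases x) (auto simp: flag_def anorm_def right_diff_distrib distrib_left)
qed

lemma weight_lmul: "weight (lmul z w) \<le> knorm z + weight w"
  using knorm_kmul[of z] by (cases w) (auto intro: order_trans)

text \<open>The letterwise bound \<open>knorm_sec\<close> is summed over the word;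
  \<open>2 * anorm\<close> is the extra charge of the two terminal letters of the sections.\<close>

lemma weight_sec: "weight (sec False w) + weight (sec True w) \<le> eta * weight w + 2 * anorm"
proof (induction w)
  case (End x)
  then show ?case using knorm_sec[of x] by (auto split: if_splits)
next
  case (Step x w)
  then show ?case
    using knorm_sec[of x] weight_lmul[of "rot x" "sec True w"]
    by (auto simp: distrib_left split: if_splits)
qed

lemma knorm_anorm_bounds: "anorm \<le> knorm x + anorm" "knorm x + anorm \<le> 1"
  using knorm_nonneg[of x] eta_bounds eta_powers eta_cubic by (cases x; auto simp: anorm_def)+

lemma weight_bounds: "anorm * (len w + 1) \<le> weight w" "weight w \<le> len w + 1"
proof -
  show "anorm * (len w + 1) \<le> weight w"
  proof (induction w)
    case (Step x w)
    then show ?case using knorm_anorm_bounds[of x] by (simp add: algebra_simps)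
  qed (use knorm_anorm_bounds in auto)
  show "weight w \<le> len w + 1"
  proof (induction w)
    case (Step x w)
    then show ?case using knorm_anorm_bounds[of x] by simp
  qed (use knorm_anorm_bounds in auto)
qed

lemma weight_pos: "0 < weight w"
proof -
  have "0 < anorm * (len w + 1)" using anorm_pos by simp
  then show ?thesis using weight_bounds(1)[of w] by linarith
qed

lemma finite_UNIV_klein: "finite (UNIV :: klein set)"
proof -
  have "UNIV = {kI, kB, kC, kD}" using klein.exhaust by blast
  then show ?thesis by (metis finite.emptyI finite_insert)
qed

lemma finite_len_le: "finite {w. len w \<le> n}"
proof (induction n)
  case 0
  have "{w. len w \<le> 0} = range End"
  proof -
    have "w \<in> range End" if "len w \<le> 0" for w using that by (cases w) auto
    then show ?thesis by auto
  qed
  then show ?case using finite_UNIV_klein by simp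
next
  case (Suc n)
  have "{w. len w \<le> Suc n} \<subseteq> range End \<union> (\<lambda>(x, w). Step x w) ` (UNIV \<times> {w. len w \<le> n})"
  proof
    fix w assume "w \<in> {w. len w \<le> Suc n}"
    then show "w \<in> range End \<union> (\<lambda>(x, w). Step x w) ` (UNIV \<times> {w. len w \<le> n})"
      by (cases w) auto
  qed
  moreover have "finite (range End \<union> (\<lambda>(x, w). Step x w) ` (UNIV \<times> {w. len w \<le> n}))"
    using Suc finite_UNIV_klein by auto
  ultimately show ?case by (rule finite_subset)
qed

lemma finite_weight_le: "finite {w. weight w \<le> K}"
proof -
  have "len w \<le> nat \<lfloor>K / anorm\<rfloor>" if "weight w \<le> K" for w
  proof -
    have "anorm * len w \<le> K" using weight_bounds(1)[of w] that anorm_pos by (simp add: algebra_simps)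
    then have "real (len w) \<le> K / anorm" using anorm_pos by (simp add: field_simps)
    then show ?thesis by (simp add: le_nat_floor)
  qed
  then have "{w. weight w \<le> K} \<subseteq> {w. len w \<le> nat \<lfloor>K / anorm\<rfloor>}" by auto
  then show ?thesis using finite_len_le finite_subset by blast
qed

section \<open>Concavity and the bound on the number of leaves\<close>

lemma powr_midpoint_concave:
  fixes u v p :: real
  assumes "0 < u" "0 < v" "0 < p" "p < 1"
  shows "u powr p + v powr p \<le> 2 * ((u + v) / 2) powr p"
proof -
  define q where "q = 1 / p"
  define x where "x = u powr p"
  define y where "y = v powr p"
  have q: "q \<ge> 1" using assms by (simp add: q_def)
  have xy: "0 < x" "0 < y" "x powr q = u" "y powr q = v"
    unfolding x_def y_def q_def using assms by (auto simp: powr_powr)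
  \<comment> \<open>Concavity of the power \<open>p\<close> is read off from convexity of its
    inverse, the power \<open>q\<close>, at the points \<open>x\<close> and
    \<open>y\<close>.\<close>
  have "((1 - 1/2) *\<^sub>R x + (1/2) *\<^sub>R y) powr q \<le> (1 - 1/2) * x powr q + (1/2) * y powr q"
    using xy by (intro convex_onD[OF powr_convex[OF q]]) auto
  then have "((x + y) / 2) powr q \<le> (u + v) / 2"
    using xy by (simp add: field_simps)
  then have "(((x + y) / 2) powr q) powr p \<le> ((u + v) / 2) powr p"
    using assms by (intro powr_mono2) auto
  moreover have "(((x + y) / 2) powr q) powr p = (x + y) / 2"
    using assms xy by (simp add: powr_powr q_def)
  ultimately show ?thesis by (simp add: x_def y_def)
qed

lemma powr_shift_difference_small:
  fixes r p e :: real
  assumes "0 < p" "p < 1" "0 < e"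
  shows "\<forall>\<^sub>F t in at_top. (t + r) powr p - (t + 1) powr p \<le> e"
proof -
  have "((\<lambda>t. (t + r) powr p - (t + 1) powr p) \<longlongrightarrow> 0) at_top"
    using assms by real_asymp
  from order_tendstoD(2)[OF this assms(3)] show ?thesis
    by (rule eventually_mono) simp
qed

text \<open>Two children subtract 1 twice, their parent only once: this slack absorbs the additive
  constant of \<open>weight_sec\<close>. The factor 2 keeps the bound at least 1.\<close>

definition leaf_bound :: "real \<Rightarrow> real" where
  "leaf_bound t = 2 * (t + 1) powr alpha - 1"

lemma leaf_bound_ge_1: "0 \<le> t \<Longrightarrow> 1 \<le> leaf_bound t"
  using ge_one_powr_ge_zero[of "t + 1" alpha] alpha_bounds by (simp add: leaf_bound_def)

lemma leaf_bound_recursion: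
  "\<exists>K\<ge>4. \<forall>t u v. K < t \<longrightarrow> 0 \<le> u \<longrightarrow> 0 \<le> v \<longrightarrow> u + v \<le> eta * t + 2 * anorm \<longrightarrow>
     leaf_bound u + leaf_bound v \<le> leaf_bound t"
proof -
  \<comment> \<open>With this \<open>r\<close>, \<open>(eta / 2) * (t + r)\<close> is the largest
    possible mean of \<open>u + 1\<close> and \<open>v + 1\<close>.\<close>
  define r where "r = 2 * (anorm + 1) / eta"
  \<comment> \<open>The tolerance 1/2, doubled by the factor in \<open>leaf_bound\<close>, uses up
    exactly the slack 1.\<close>
  obtain K0 where K0: "\<And>t. t \<ge> K0 \<Longrightarrow> (t + r) powr alpha - (t + 1) powr alpha \<le> 1 / 2"
    using powr_shift_difference_small[OF alpha_bounds, of "1/2" r]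
    by (auto simp: eventually_at_top_linorder)
  show ?thesis
  proof (rule exI[of _ "max K0 4"], intro conjI allI impI)
    fix t u v assume t: "max K0 4 < t" and uv: "0 \<le> u" "0 \<le> v" "u + v \<le> eta * t + 2 * anorm"
    have "(u + 1) powr alpha + (v + 1) powr alpha \<le> 2 * ((u + 1 + (v + 1)) / 2) powr alpha"
      using uv alpha_bounds by (intro powr_midpoint_concave) auto
    also have "\<dots> \<le> 2 * ((eta / 2) * (t + r)) powr alpha"
    proof -
      have "(eta / 2) * (t + r) = (eta * t + 2 * anorm) / 2 + 1"
        using eta_bounds by (simp add: r_def field_simps)
      then show ?thesis
        using uv alpha_bounds by (intro mult_left_mono powr_mono2) auto
    qed
    also have "\<dots> = 2 * ((eta / 2) powr alpha * (t + r) powr alpha)"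
    proof -
      have "0 \<le> t + r" using t eta_bounds anorm_pos by (simp add: r_def)
      then show ?thesis using eta_bounds powr_mult[of "eta / 2" "t + r" alpha] by simp
    qed
    also have "(eta / 2) powr alpha = 1 / 2"
    proof -
      have "(eta / 2) powr alpha = inverse ((2 / eta) powr alpha)"
        using eta_bounds by (simp add: powr_divide)
      then show ?thesis by (simp add: two_over_eta_powr)
    qed
    finally show "leaf_bound u + leaf_bound v \<le> leaf_bound t"
      using K0[of t] t by (simp add: leaf_bound_def)
  qed auto
qed

section \<open>Portraits\<close>

datatype portrait = Leaf word | Node bool portrait portrait

text \<open>As with \<open>sec\<close>, the child is selected by the parity of the value;
  \<open>p\<close> records whether parity is reversed.\<close>

primrec tact :: "portrait \<Rightarrow> nat \<Rightarrow> nat" where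
  "tact (Leaf w) = wact w"
| "tact (Node p t0 t1) = (\<lambda>n. if odd n \<noteq> p then glue True (tact t1 (n div 2)) else glue False (tact t0 (n div 2)))"

primrec tpoints :: "portrait \<Rightarrow> nat set" where
  "tpoints (Leaf w) = orb w"
| "tpoints (Node p t0 t1) = glue False ` tpoints t0 \<union> glue True ` tpoints t1"

primrec leaves :: "portrait \<Rightarrow> nat" where
  "leaves (Leaf w) = 1"
| "leaves (Node p t0 t1) = leaves t0 + leaves t1"

primrec labels :: "portrait \<Rightarrow> word set" where
  "labels (Leaf w) = {w}"
| "labels (Node p t0 t1) = labels t0 \<union> labels t1"

lemma tact_Node_eq_wact:
  assumes "tact t0 = wact (sec False w)" "tact t1 = wact (sec True w)"
  shows "tact (Node (parity w) t0 t1) = wact w"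
proof
  fix n
  obtain e m where "n = glue e m" using glue_surj by blast
  moreover have "odd (glue e m) = e" "glue e m div 2 = m" by (auto simp: glue_def)
  ultimately show "tact (Node (parity w) t0 t1) n = wact w n"
    using assms by (auto simp: wact_glue)
qed

text \<open>Sections are taken until the weight is at most \<open>K\<close>, so the labels come from
  a finite set; \<open>leaf_bound_recursion\<close> supplies a suitable \<open>K\<close>.\<close>

lemma ex_portrait:
  assumes K: "4 \<le> K" "\<And>t u v. K < t \<Longrightarrow> 0 \<le> u \<Longrightarrow> 0 \<le> v \<Longrightarrow> u + v \<le> eta * t + 2 * anorm \<Longrightarrow>
     leaf_bound u + leaf_bound v \<le> leaf_bound t"
  shows "\<exists>t. tact t = wact w \<and> orb w \<subseteq> tpoints t \<and> labels t \<subseteq> {u. weight u \<le> K} \<and>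
    leaves t \<le> leaf_bound (weight w)"
proof (induction "len w" arbitrary: w rule: less_induct)
  case less
  show ?case
  proof (cases "weight w \<le> K")
    case True
    then show ?thesis
      using leaf_bound_ge_1[of "weight w"] weight_pos[of w]
      by (intro exI[of _ "Leaf w"]) auto
  next
    case False
    \<comment> \<open>The recursion terminates because words of length above 3 have strictly shorter
      sections; hence the requirement \<open>4 \<le> K\<close>.\<close>
    then have "3 < len w" using weight_bounds(2)[of w] K(1) by simp
    then have "len (sec e w) < len w" for e
      using len_sec[of w] by (cases e) auto
    from less.hyps[OF this] obtain T where T: "\<And>e. tact (T e) = wact (sec e w)"
      "\<And>e. orb (sec e w) \<subseteq> tpoints (T e)" "\<And>e. labels (T e) \<subseteq> {u. weight u \<le> K}"
      "\<And>e. leaves (T e) \<le> leaf_bound (weight (sec e w))"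
      by metis
    have "leaves (T False) + leaves (T True) \<le> leaf_bound (weight w)"
      using K(2)[OF _ _ _ weight_sec[of w]] False T(4)[of False] T(4)[of True]
        weight_pos[of "sec False w"] weight_pos[of "sec True w"] by simp
    moreover have "orb w \<subseteq> tpoints (Node (parity w) (T False) (T True))"
      unfolding tpoints.simps by (rule order_trans[OF orb_sec]) (intro Un_mono image_mono T(2))
    moreover have "labels (Node (parity w) (T False) (T True)) \<subseteq> {u. weight u \<le> K}"
      using T(3) by simp
    ultimately show ?thesis
      using tact_Node_eq_wact[OF T(1) T(1)]
      by (intro exI[of _ "Node (parity w) (T False) (T True)"] conjI) simp_all
  qed
qed

text \<open>Polish notation, used to count portraits.\<close>

primrec tokens :: "portrait \<Rightarrow> (bool + word) list" where
  "tokens (Leaf w) = [Inr w]"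
| "tokens (Node p t0 t1) = Inl p # tokens t0 @ tokens t1"

text \<open>Polish notation is prefix-free; the trailing lists let the induction pass from the first
  subtree to the second.\<close>

lemma tokens_append_inject: "tokens s @ xs = tokens t @ ys \<Longrightarrow> s = t \<and> xs = ys"
proof (induction s arbitrary: t xs ys)
  case (Leaf w)
  then show ?case by (cases t) auto
next
  case (Node p s0 s1)
  from Node.prems obtain q t0 t1 where t: "t = Node q t0 t1" by (cases t) auto
  have "s0 = t0 \<and> tokens s1 @ xs = tokens t1 @ ys"
    using Node.prems t by (intro Node.IH(1)) simp
  moreover from this have "s1 = t1 \<and> xs = ys" by (intro Node.IH(2)) simp
  ultimately show ?case using Node.prems t by simp
qed

lemma inj_tokens: "inj tokens"
  using tokens_append_inject[of _ "[]" _ "[]"] by (auto intro: injI)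

lemma length_tokens: "length (tokens t) < 2 * leaves t"
  by (induction t) auto

lemma set_tokens: "set (tokens t) \<subseteq> range Inl \<union> Inr ` labels t"
  by (induction t) auto

lemma sum_power_le: "(\<Sum>i\<le>n. q ^ i) \<le> (q + 1) ^ n" for q :: nat
proof (induction n)
  case (Suc n)
  have "q * q ^ n \<le> q * (q + 1) ^ n" by (intro mult_left_mono power_mono) auto
  then have "(\<Sum>i\<le>n. q ^ i) + q * q ^ n \<le> (q + 1) ^ n + q * (q + 1) ^ n"
    using Suc by (rule add_mono[rotated])
  then show ?case by (simp add: algebra_simps)
qed simp

text \<open>Portraits embed into lists of length at most \<open>2 * L\<close> over
  \<open>card Q + 2\<close> letters, two Booleans and the labels; summing over the lengths raises
  the base by 1.\<close>

lemma card_portraits_le: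
  fixes Q L
  assumes "finite Q"
  defines "P \<equiv> {t. labels t \<subseteq> Q \<and> leaves t \<le> L}"
  shows "finite P" "card P \<le> (card Q + 3) ^ (2 * L)"
proof -
  let ?A = "(range Inl :: (bool + word) set) \<union> Inr ` Q"
  let ?M = "{xs. set xs \<subseteq> ?A \<and> length xs \<le> 2 * L}"
  have sub: "tokens ` P \<subseteq> ?M"
  proof
    fix xs assume "xs \<in> tokens ` P"
    then obtain t where t: "labels t \<subseteq> Q" "leaves t \<le> L" "xs = tokens t" by (auto simp: P_def)
    have "range Inl \<union> Inr ` labels t \<subseteq> ?A" using t(1) by blast
    from order_trans[OF set_tokens this] show "xs \<in> ?M"
      using t(2,3) length_tokens[of t] by simp
  qed
  have fin: "finite ?A" using assms by simp
  have finM: "finite ?M" by (rule finite_lists_length_le[OF fin])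
  show "finite P"
    using finite_subset[OF sub finM] inj_tokens by (metis finite_imageD inj_on_subset subset_UNIV)
  have "card P = card (tokens ` P)"
    using inj_tokens by (metis card_image inj_on_subset subset_UNIV)
  also have "\<dots> \<le> card ?M" by (rule card_mono[OF finM sub])
  also have "\<dots> = (\<Sum>i\<le>2 * L. card ?A ^ i)" by (rule card_lists_length_le[OF fin])
  also have "\<dots> = (\<Sum>i\<le>2 * L. (card Q + 2) ^ i)"
  proof -
    have "card ?A = card (range Inl :: (bool + word) set) + card (Inr ` Q :: (bool + word) set)"
      using assms by (intro card_Un_disjoint) auto
    also have "\<dots> = card Q + 2" by (simp add: card_image)
    finally show ?thesis by simp
  qed
  also have "\<dots> \<le> (card Q + 3) ^ (2 * L)"
    using sum_power_le[of "card Q + 2" "2 * L"] by (simp add: numeral_3_eq_3)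
  finally show "card P \<le> (card Q + 3) ^ (2 * L)" .
qed

lemma finite_tpoints: "finite (tpoints t)"
  by (induction t) auto

lemma card_tpoints_le:
  assumes "\<And>w. w \<in> labels t \<Longrightarrow> card (orb w) \<le> M"
  shows "card (tpoints t) \<le> M * leaves t"
  using assms
proof (induction t)
  case (Node p t0 t1)
  have "card (tpoints (Node p t0 t1)) \<le> card (glue False ` tpoints t0) + card (glue True ` tpoints t1)"
    by (simp add: card_Un_le)
  also have "\<dots> \<le> card (tpoints t0) + card (tpoints t1)"
    by (intro add_mono card_image_le finite_tpoints)
  also have "\<dots> \<le> M * leaves t0 + M * leaves t1"
    using Node by (intro add_mono) auto
  finally show ?case by (simp add: algebra_simps)
qed auto

text \<open>The sections of \<open>subst w\<close> are \<open>w\<close> and \<open>a w\<close>, up to terminal letters. The substitution multiplies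
  the weights by \<open>2 / eta\<close> thanks to the defining equation of \<open>eta\<close>.\<close>

primrec subst :: "word \<Rightarrow> word" where
  "subst (End x) = Step kB (End x)"
| "subst (Step x w) = (if x = kB then Step kB (Step kD (Step kC (subst w)))
     else if x = kC then Step kB (Step kB (subst w)) else Step kC (Step kC (subst w)))"

primrec no_kI :: "word \<Rightarrow> bool" where
  "no_kI (End x) = True"
| "no_kI (Step x w) \<longleftrightarrow> x \<noteq> kI \<and> no_kI w"

lemma no_kI_subst: "no_kI w \<Longrightarrow> no_kI (subst w)"
  by (induction w) auto

text \<open>Each half of the numbers receives a full copy of \<open>orb w\<close>, the odd one
  displaced by \<open>flip\<close> because the other section is a w.\<close>

lemma orb_subst:
  assumes "no_kI w"
  shows "glue False ` orb w \<union> (glue True \<circ> flip) ` orb w \<subseteq> orb (subst w)"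
  using assms
proof (induction w)
  case (End x)
  then show ?case by (auto simp: glue_def flip_def kact.simps flag_def)
next
  case (Step x w)
  define f where "f = (\<lambda>x m. kact x (flip m))"
  let ?O = "orb (subst (Step x w))"
  \<comment> \<open>The partner of the base point in the odd half appears after the first letter,
    since every block begins with b or c.\<close>
  have three: "glue True (flip 0) \<in> ?O"
  proof -
    have "flip 0 = glue True 0" by (simp add: glue_def flip_def)
    then have "glue True (flip 0) = kact y (flip 0)" if "flag y" for y
      using that by (simp add: kact_glue)
    then show ?thesis using Step.prems by (auto simp: flag_def image_iff)
  qed
  \<comment> \<open>The block replacing \<open>x\<close> carries the pair of points belonging to
    \<open>m\<close> to the pair belonging to \<open>f x m\<close>; the block for b, having odd
    length, exchanges the halves.\<close>
  have step: "glue False (f x m) \<in> ?O \<and> glue True (flip (f x m)) \<in> ?O" if "m \<in> orb w" for m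
  proof -
    have E: "glue False m \<in> orb (subst w)" and D: "glue True (flip m) \<in> orb (subst w)"
      using Step that by auto
    consider "x = kB" | "x = kC" | "x = kD" using Step.prems by (cases x) auto
    then show ?thesis
    proof cases
      case 1
      have *: "f kB (f kD (f kC y)) \<in> ?O" if "y \<in> orb (subst w)" for y
        using that 1 by (auto simp: f_def)
      have "kact kC (kact kD n) = kact kB n" for n using kact_kmul[of kC kD n] by simp
      then show ?thesis
        using *[OF E] *[OF D] 1 by (simp add: f_def kact_glue flag_def)
    next
      case 2
      have *: "f kB (f kB y) \<in> ?O" if "y \<in> orb (subst w)" for y
        using that 2 by (auto simp: f_def)
      show ?thesis
        using *[OF E] *[OF D] 2 by (simp add: f_def kact_glue flag_def)
    next
      case 3
      have *: "f kC (f kC y) \<in> ?O" if "y \<in> orb (subst w)" for y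
        using that 3 by (auto simp: f_def)
      show ?thesis
        using *[OF E] *[OF D] 3 by (simp add: f_def kact_glue flag_def)
    qed
  qed
  have "glue False n \<in> ?O \<and> glue True (flip n) \<in> ?O" if "n \<in> orb (Step x w)" for n
  proof -
    from that consider "n = 0" | m where "m \<in> orb w" "n = f x m" by (auto simp: f_def)
    then show ?thesis
    proof cases
      case 1
      moreover have "glue False 0 \<in> ?O" by (simp add: glue_def)
      ultimately show ?thesis using three by metis
    qed (use step in metis)
  qed
  then show ?case by (intro Un_least image_subsetI) (simp_all only: o_def)
qed

lemma card_orb_subst:
  assumes "no_kI w"
  shows "2 * card (orb w) \<le> card (orb (subst w))"
proof -
  have inj: "inj (glue False)" "inj (glue True \<circ> flip)"
    using inj_on_inverseI[of UNIV flip flip] by (auto simp: inj_def glue_def)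
  have "glue False ` orb w \<inter> (glue True \<circ> flip) ` orb w = {}"
    using double_not_eq_Suc_double by (auto simp: glue_def)
  then have "card (glue False ` orb w \<union> (glue True \<circ> flip) ` orb w) =
      card (glue False ` orb w) + card ((glue True \<circ> flip) ` orb w)"
    by (intro card_Un_disjoint) auto
  also have "\<dots> = 2 * card (orb w)"
    using inj[THEN inj_on_subset, OF subset_UNIV] by (simp only: card_image)
  finally show ?thesis
    using card_mono[OF finite_orb orb_subst[OF assms]] by simp
qed

text \<open>The weight of the terminal letter is chosen to make \<open>subst\<close> scale \<open>step_weight\<close> exactly.\<close>

primrec step_weight :: "word \<Rightarrow> real" where
  "step_weight (End x) = eta / (2 - eta)"
| "step_weight (Step x w) = knorm x + anorm + step_weight w"

lemma knorm_anorm_eq: "knorm kB + anorm = 1" "knorm kC + anorm = eta" "knorm kD + anorm = eta^2"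
  using eta_cubic by (simp_all add: anorm_def)

text \<open>For the block of b, scaling amounts to \<open>1 + eta + eta^2 = 2 / eta\<close>, which
  is the cubic equation divided by \<open>eta\<close>.\<close>

lemma step_weight_subst: "no_kI w \<Longrightarrow> step_weight (subst w) = (2 / eta) * step_weight w"
proof (induction w)
  case (End x)
  then show ?case using eta_bounds knorm_anorm_eq(1) by (simp add: field_simps)
next
  case (Step x w)
  have "eta * (1 + eta + eta^2) = 2"
    using eta_cubic by (simp add: algebra_simps power2_eq_square power3_eq_cube)
  then have "1 + eta + eta^2 = 2 / eta" using eta_bounds by (simp add: field_simps)
  then have "(knorm kB + anorm) + (knorm kD + anorm) + (knorm kC + anorm) = (2 / eta) * (knorm kB + anorm)"
    "2 * (knorm kB + anorm) = (2 / eta) * (knorm kC + anorm)"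
    "2 * (knorm kC + anorm) = (2 / eta) * (knorm kD + anorm)"
    unfolding knorm_anorm_eq using eta_bounds by (simp_all add: power2_eq_square)
  then show ?case
    using Step by (cases x) (simp_all del: knorm.simps add: distrib_left)
qed

lemma len_le_step_weight: "no_kI w \<Longrightarrow> eta^2 * len w \<le> step_weight w"
proof (induction w)
  case (Step x w)
  then have "eta^2 \<le> knorm x + anorm"
    using eta_bounds eta_powers knorm_anorm_eq by (cases x) (auto simp del: knorm.simps)
  then show ?case using Step by (simp add: algebra_simps)
qed (use eta_bounds in auto)

lemma ex_word_large_orb:
  "\<exists>w. 2 ^ k \<le> card (orb w) \<and> eta^2 * len w \<le> eta / (2 - eta) * (2 / eta) ^ k"
proof -
  define w where "w = (subst ^^ k) (End kI)"
  have "no_kI w \<and> 2 ^ k \<le> card (orb w) \<and> step_weight w = eta / (2 - eta) * (2 / eta) ^ k"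
    unfolding w_def
  proof (induction k)
    case (Suc k)
    then show ?case
      using no_kI_subst card_orb_subst[of "(subst ^^ k) (End kI)"] step_weight_subst
      by (auto intro: order_trans[rotated])
  qed auto
  then show ?thesis using len_le_step_weight by metis
qed

section \<open>Transitivity on the orbit of 0\<close>

inductive reach :: "nat \<Rightarrow> bool" where
  "reach 0"
| "reach n \<Longrightarrow> reach (flip n)"
| "reach n \<Longrightarrow> reach (kact x n)"

text \<open>Every generator lifts to the even numbers: a b a acts there as a, and \<open>rot\<close>
  attains every letter.\<close>

lemma reach_double: "reach n \<Longrightarrow> reach (2 * n)"
proof (induction rule: reach.induct)
  case (2 n)
  have "2 * flip n = flip (kact kB (flip (2 * n)))" by (simp add: flag_def)
  then show ?case using 2 reach.intros by metis
next
  case (3 n x)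
  obtain y where "rot y = x" by (cases x) (metis rot.simps)+
  then have "2 * kact x n = kact y (2 * n)" by simp
  then show ?case using 3 reach.intros by metis
qed (simp add: reach.intros)

lemma reach_all: "reach n"
proof (induction n rule: double_induct)
  case (odd n)
  then show ?case using reach.intros(2)[OF reach_double] by simp
qed (simp_all add: reach.intros reach_double)

section \<open>Adjoining a transposition with a fixed point\<close>

abbreviation swap :: "'a \<Rightarrow> 'a \<Rightarrow> 'a \<Rightarrow> 'a" where
  "swap \<equiv> Transposition.transpose"

definition gens :: "(nat option \<Rightarrow> nat option) set" where
  "gens = insert (swap (Some 0) None) (insert (map_option flip) (map_option ` range kact))"

primrec comp_list :: "('a \<Rightarrow> 'a) list \<Rightarrow> 'a \<Rightarrow> 'a" where
  "comp_list [] = id"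
| "comp_list (f # fs) = f \<circ> comp_list fs"

definition prods :: "nat \<Rightarrow> (nat option \<Rightarrow> nat option) set" where
  "prods n = {comp_list ls | ls. set ls \<subseteq> gens \<and> length ls \<le> n}"

lemma map_option_o: "map_option (f \<circ> g) = map_option f \<circ> map_option g"
  by (simp add: fun_eq_iff option.map_comp)

lemma finite_gens: "finite gens"
  by (simp add: gens_def finite_UNIV_klein)

lemma gens_cases:
  assumes "s \<in> gens"
  obtains "s = swap (Some 0) None" | "s = map_option flip" | x where "s = map_option (kact x)"
  using assms by (auto simp: gens_def)

lemma in_gens: "swap (Some 0) None \<in> gens" "map_option flip \<in> gens" "map_option (kact x) \<in> gens"
  by (auto simp: gens_def)

lemma gens_involution: "s \<in> gens \<Longrightarrow> s \<circ> s = id"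
  by (erule gens_cases) (auto simp: fun_eq_iff option.map_comp o_def option.map_ident)

lemma id_in_prods: "id \<in> prods n"
  unfolding prods_def by (auto intro!: exI[of _ "[]"])

lemma comp_list_append: "comp_list (xs @ ys) = comp_list xs \<circ> comp_list ys"
  by (induction xs) (auto simp: o_assoc)

lemma prods_comp: "f \<in> prods m \<Longrightarrow> g \<in> prods n \<Longrightarrow> f \<circ> g \<in> prods (m + n)"
proof -
  assume "f \<in> prods m" "g \<in> prods n"
  then obtain xs ys where "set xs \<subseteq> gens" "length xs \<le> m" "f = comp_list xs"
    "set ys \<subseteq> gens" "length ys \<le> n" "g = comp_list ys"
    unfolding prods_def by blast
  then show ?thesis unfolding prods_def
    by (intro CollectI exI[of _ "xs @ ys"]) (auto simp: comp_list_append)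
qed

lemma gens_prods: "s \<in> gens \<Longrightarrow> s \<in> prods (Suc 0)"
  unfolding prods_def by (auto intro!: exI[of _ "[s]"])

lemma prods_mono: "m \<le> n \<Longrightarrow> prods m \<subseteq> prods n"
  unfolding prods_def by fastforce

lemma finite_prods: "finite (prods n)"
proof -
  have "prods n = (\<lambda>ls. comp_list ls) ` {ls. set ls \<subseteq> gens \<and> length ls \<le> n}"
    unfolding prods_def by auto
  then show ?thesis using finite_lists_length_le[OF finite_gens] by simp
qed

lemma prods_0: "prods 0 = {id}"
  unfolding prods_def by auto

lemma prods_Suc: "prods (Suc n) = prods n \<union> {f \<circ> s | f s. f \<in> prods n \<and> s \<in> gens}"
proof
  show "prods (Suc n) \<subseteq> prods n \<union> {f \<circ> s | f s. f \<in> prods n \<and> s \<in> gens}"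
  proof
    fix f assume "f \<in> prods (Suc n)"
    then obtain ls where ls: "set ls \<subseteq> gens" "length ls \<le> Suc n" "f = comp_list ls"
      unfolding prods_def by blast
    show "f \<in> prods n \<union> {f \<circ> s | f s. f \<in> prods n \<and> s \<in> gens}"
    proof (cases ls rule: rev_cases)
      case Nil
      then show ?thesis using ls id_in_prods by simp
    next
      case (snoc xs s)
      then have "comp_list xs \<in> prods n" using ls unfolding prods_def by auto
      moreover have "f = comp_list xs \<circ> s" using ls snoc by (simp add: comp_list_append)
      ultimately show ?thesis using ls snoc by auto
    qed
  qed
  show "prods n \<union> {f \<circ> s | f s. f \<in> prods n \<and> s \<in> gens} \<subseteq> prods (Suc n)"
    using prods_mono[of n "Suc n"] prods_comp[of _ n _ "Suc 0"] gens_prods by auto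
qed

lemma prods_inverse: "f \<in> prods n \<Longrightarrow> \<exists>g \<in> prods n. g \<circ> f = id"
proof (induction n arbitrary: f)
  case 0
  then show ?case by (simp add: prods_0)
next
  case (Suc n)
  from Suc.prems consider "f \<in> prods n" | g s where "g \<in> prods n" "s \<in> gens" "f = g \<circ> s"
    unfolding prods_Suc by blast
  then show ?case
  proof cases
    case 1
    then show ?thesis using Suc.IH prods_mono[of n "Suc n"] by (meson in_mono le_SucI order_refl)
  next
    case (2 g s)
    then obtain h where h: "h \<in> prods n" "h \<circ> g = id" using Suc.IH by blast
    have "(s \<circ> h) \<circ> f = s \<circ> (h \<circ> g) \<circ> s" using 2 by (simp add: o_assoc)
    also have "\<dots> = id" using h(2) gens_involution[OF 2(2)] by simp
    finally have "(s \<circ> h) \<circ> f = id" .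
    moreover have "s \<circ> h \<in> prods (Suc n)"
      using prods_comp[OF gens_prods[OF 2(2)] h(1)] by simp
    ultimately show ?thesis by blast
  qed
qed

text \<open>Distinct star transpositions \<open>swap (Some y) None\<close> multiply to a cycle, hence a product of
  them is determined up to order by its support.\<close>

lemma ex_prod_with_support:
  assumes "T \<subseteq> orb w"
  shows "\<exists>f. f \<circ> map_option (wact w) \<in> prods (3 * len w + 2) \<and> {y. f (Some y) \<noteq> Some y} = T"
  using assms
proof (induction w arbitrary: T)
  case (End x)
  then consider "T = {}" | "T = {0}" by auto
  then show ?case
  proof cases
    case 1
    have "map_option (kact x) \<in> prods (3 * len (End x) + 2)"
      using gens_prods[OF in_gens(3)] prods_mono[of "Suc 0" "3 * len (End x) + 2"] by auto
    then show ?thesis using 1 by (intro exI[of _ id]) simp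
  next
    case 2
    have "swap (Some 0) None \<circ> map_option (wact (End x)) \<in> prods (3 * len (End x) + 2)"
      using prods_comp[OF gens_prods[OF in_gens(1)] gens_prods[OF in_gens(3)]]
      by (simp only: wact.simps len.simps) (simp add: numeral_2_eq_2)
    moreover have "{y. swap (Some 0) None (Some y) \<noteq> Some y} = T"
      using 2 by (auto simp: Transposition.transpose_def)
    ultimately show ?thesis by blast
  qed
next
  case (Step x w)
  define g where "g = kact x \<circ> flip"
  define g' where "g' = flip \<circ> kact x"
  have gg: "g (g' y) = y" "g' (g y) = y" for y by (auto simp: g_def g'_def)
  \<comment> \<open>The point 0 is left out, because the factor \<open>s\<close> alone decides
    whether it is moved.\<close>
  define T' where "T' = {y \<in> orb w. g y \<in> T \<and> g y \<noteq> 0}"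
  have T: "T - {0} = g ` T'" using Step.prems by (auto simp: T'_def g_def)
  have "T' \<subseteq> orb w" by (auto simp: T'_def)
  from Step.IH[OF this] obtain f where
    f: "f \<circ> map_option (wact w) \<in> prods (3 * len w + 2)" "{y. f (Some y) \<noteq> Some y} = T'"
    by blast
  define s where "s = (if 0 \<in> T then swap (Some 0) None else (id :: nat option \<Rightarrow> nat option))"
  define f' where "f' = s \<circ> (map_option g \<circ> f \<circ> map_option g')"
  have s: "s \<in> prods (Suc 0)"
    using gens_prods[OF in_gens(1)] id_in_prods by (simp add: s_def)
  have g_prods: "map_option g \<in> prods 2"
    unfolding g_def map_option_o
    using prods_comp[OF gens_prods[OF in_gens(3)] gens_prods[OF in_gens(2)]]
    by (simp add: numeral_2_eq_2)
  \<comment> \<open>Each step costs three generators: at most one transposition in \<open>s\<close>,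
    a letter and \<open>flip\<close>.\<close>
  have length_eq: "Suc 0 + (2 + (3 * len w + 2)) = 3 * len (Step x w) + 2" by simp
  from prods_comp[OF s prods_comp[OF g_prods f(1)]]
  have "s \<circ> (map_option g \<circ> (f \<circ> map_option (wact w))) \<in> prods (3 * len (Step x w) + 2)"
    unfolding length_eq .
  moreover have "f' \<circ> map_option (wact (Step x w)) = s \<circ> (map_option g \<circ> (f \<circ> map_option (wact w)))"
    by (simp add: f'_def fun_eq_iff option.map_comp g'_def o_def)
  ultimately have "f' \<circ> map_option (wact (Step x w)) \<in> prods (3 * len (Step x w) + 2)" by simp
  moreover have "f' (Some y) \<noteq> Some y \<longleftrightarrow> y \<in> T" for y
  proof -
    have h: "(map_option g \<circ> f \<circ> map_option g') (Some y) \<noteq> Some y \<longleftrightarrow> y \<in> T - {0}"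
    proof -
      have "map_option g z = Some y \<longleftrightarrow> z = Some (g' y)" for z
      proof -
        have "g a = y \<longleftrightarrow> a = g' y" for a using gg by metis
        then show ?thesis by (cases z) simp_all
      qed
      then have "(map_option g \<circ> f \<circ> map_option g') (Some y) \<noteq> Some y \<longleftrightarrow> f (Some (g' y)) \<noteq> Some (g' y)"
        by simp
      also have "\<dots> \<longleftrightarrow> g' y \<in> T'" using f(2) by blast
      also have "\<dots> \<longleftrightarrow> y \<in> T - {0}" unfolding T using gg by (metis image_iff)
      finally show ?thesis .
    qed
    show ?thesis
    proof (cases "y = 0")
      case True
      then have eq: "(map_option g \<circ> f \<circ> map_option g') (Some y) = Some y" using h by blast
      have "f' (Some y) = s (Some y)"
        unfolding f'_def comp_apply[of s "map_option g \<circ> f \<circ> map_option g'"] eq ..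
      then show ?thesis using True by (simp add: s_def)
    next
      case False
      then have "s z = Some y \<longleftrightarrow> z = Some y" for z
        by (auto simp: s_def Transposition.transpose_def)
      then have "f' (Some y) \<noteq> Some y \<longleftrightarrow> (map_option g \<circ> f \<circ> map_option g') (Some y) \<noteq> Some y"
        unfolding f'_def by simp
      then show ?thesis using h False by blast
    qed
  qed
  ultimately show ?case by blast
qed

lemma surj_wact: "surj (wact w)"
proof -
  have "surj (kact x)" for x by (rule surjI[of _ "kact x"]) simp
  moreover have "surj flip" by (rule surjI[of _ flip]) simp
  ultimately show ?thesis
    by (induction w) (simp_all only: wact.simps comp_surj)
qed

text \<open>All subsets of the inverted orbit use the same word, whose surjective action cancels;
  the support of the remaining factor then recovers the subset.\<close>

lemma card_prods_lower: "2 ^ card (orb w) \<le> card (prods (3 * len w + 2))"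
proof -
  obtain F where F: "\<And>T. T \<subseteq> orb w \<Longrightarrow> F T \<circ> map_option (wact w) \<in> prods (3 * len w + 2)"
    "\<And>T. T \<subseteq> orb w \<Longrightarrow> {y. F T (Some y) \<noteq> Some y} = T"
    using ex_prod_with_support[of _ w] by metis
  have "inj_on (\<lambda>T. F T \<circ> map_option (wact w)) (Pow (orb w))"
  proof (rule inj_onI)
    fix T U assume TU: "T \<in> Pow (orb w)" "U \<in> Pow (orb w)"
      and eq: "F T \<circ> map_option (wact w) = F U \<circ> map_option (wact w)"
    have "F T (Some y) = F U (Some y)" for y
    proof -
      obtain z where "y = wact w z" using surj_wact by (metis surjD)
      then show ?thesis using fun_cong[OF eq, of "Some z"] by simp
    qed
    then have "{y. F T (Some y) \<noteq> Some y} = {y. F U (Some y) \<noteq> Some y}" by simp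
    moreover have "T \<subseteq> orb w" "U \<subseteq> orb w" using TU by auto
    ultimately show "T = U" unfolding F(2)[OF \<open>T \<subseteq> orb w\<close>] F(2)[OF \<open>U \<subseteq> orb w\<close>] by simp
  qed
  then have "card (Pow (orb w)) \<le> card (prods (3 * len w + 2))"
    using F(1) finite_prods by (intro card_inj_on_le) auto
  then show ?thesis by (simp add: card_Pow)
qed

lemma permutes_bijI: "bij p \<Longrightarrow> (\<And>x. x \<notin> S \<Longrightarrow> p x = x) \<Longrightarrow> p permutes S"
  unfolding permutes_def by (metis bij_iff)

lemma permutes_conj:
  assumes "p permutes A" "g \<circ> g = id"
  shows "g \<circ> p \<circ> g permutes g ` A"
proof (rule permutes_bijI)
  have "bij g" using assms(2) by (metis o_bij)
  then show "bij (g \<circ> p \<circ> g)" using permutes_bij[OF assms(1)] by (intro bij_comp)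
next
  fix y assume y: "y \<notin> g ` A"
  have gg: "g (g z) = z" for z using fun_cong[OF assms(2), of z] by simp
  then have "g y \<notin> A" using y by (metis imageI)
  then show "(g \<circ> p \<circ> g) y = y" using assms(1) gg by (simp add: permutes_not_in)
qed

text \<open>All transpositions are moved to the left of the word. Conjugation by a generator of G
  moves the support exactly as prefixing that generator moves the inverted orbit.\<close>

lemma prods_decompose:
  assumes "f \<in> prods n"
  shows "\<exists>w p. f = p \<circ> map_option (wact w) \<and> len w \<le> n \<and> p permutes insert None (Some ` orb w)"
proof -
  obtain ls where ls: "set ls \<subseteq> gens" "length ls \<le> n" "f = comp_list ls"
    using assms unfolding prods_def by blast
  have "\<exists>w p. comp_list ls = p \<circ> map_option (wact w) \<and> len w \<le> length ls \<and>
      p permutes insert None (Some ` orb w)"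
    using ls(1)
  proof (induction ls)
    case Nil
    show ?case
    proof (intro exI conjI)
      show "comp_list [] = id \<circ> map_option (wact (End kI))"
        by (simp only: comp_list.simps wact.simps kact_kI option.map_id0 id_o)
      show "id permutes insert None (Some ` orb (End kI))" by (rule permutes_id)
    qed simp
  next
    case (Cons s ls)
    then have "set ls \<subseteq> gens" by simp
    from Cons.IH[OF this] obtain w p where wp: "comp_list ls = p \<circ> map_option (wact w)" "len w \<le> length ls"
      "p permutes insert None (Some ` orb w)" by blast
    have conj: ?case
      if g: "s = map_option g" "s \<circ> s = id" and v: "wact v = g \<circ> wact w" "g ` orb w \<subseteq> orb v"
        "len v \<le> Suc (len w)" for g v
    proof -
      have "s \<circ> p \<circ> s permutes s ` insert None (Some ` orb w)"
        by (rule permutes_conj[OF wp(3) g(2)])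
      moreover have "s ` insert None (Some ` orb w) \<subseteq> insert None (Some ` orb v)"
        using v(2) g(1) by auto
      ultimately have "s \<circ> p \<circ> s permutes insert None (Some ` orb v)"
        by (rule permutes_subset)
      moreover have "comp_list (s # ls) = (s \<circ> p \<circ> s) \<circ> map_option (wact v)"
      proof -
        have "(s \<circ> p \<circ> s) \<circ> map_option (wact v) = s \<circ> p \<circ> (s \<circ> s) \<circ> map_option (wact w)"
          unfolding v(1) map_option_o g(1)[symmetric] by (simp only: o_assoc)
        then show ?thesis using wp(1) g(2) by (simp add: o_assoc)
      qed
      moreover have "len v \<le> length (s # ls)" using v(3) wp(2) by simp
      ultimately show ?thesis by blast
    qed
    have "s \<in> gens" using Cons.prems by simp
    note inv = gens_involution[OF this]
    from \<open>s \<in> gens\<close> show ?case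
    proof (cases rule: gens_cases)
      case 1
      then have "s permutes insert None (Some ` orb w)"
        by (auto intro!: permutes_swap_id)
      then have "s \<circ> p permutes insert None (Some ` orb w)"
        using wp(3) by (rule permutes_compose[rotated])
      moreover have "comp_list (s # ls) = s \<circ> p \<circ> map_option (wact w)"
        using wp(1) by (simp only: comp_list.simps o_assoc)
      moreover have "len w \<le> length (s # ls)" using wp(2) by simp
      ultimately show ?thesis by blast
    next
      case 2
      show ?thesis by (rule conj[OF 2 inv, of "Step kI w"]) auto
    next
      case (3 x)
      show ?thesis by (rule conj[OF 3 inv, of "lmul x w"]) auto
    qed
  qed
  then show ?thesis using ls by (metis le_trans)
qed

text \<open>A product is determined by a portrait and a permutation of its points together with
  \<open>None\<close>, which accounts for the \<open>+ 1\<close> in the factorial. A word of length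
  at most \<open>n\<close> has weight at most \<open>n + 1\<close>.\<close>

lemma card_prods_upper:
  "\<exists>q M. q > 0 \<and> (\<forall>n. card (prods n) \<le> q ^ (2 * nat \<lfloor>leaf_bound (real n + 1)\<rfloor>)
     * fact (M * nat \<lfloor>leaf_bound (real n + 1)\<rfloor> + 1))"
proof -
  obtain K where K: "4 \<le> K" "\<And>t u v. K < t \<Longrightarrow> 0 \<le> u \<Longrightarrow> 0 \<le> v \<Longrightarrow>
      u + v \<le> eta * t + 2 * anorm \<Longrightarrow> leaf_bound u + leaf_bound v \<le> leaf_bound t"
    using leaf_bound_recursion by blast
  define Q where "Q = {w. weight w \<le> K}"
  have finQ: "finite Q" unfolding Q_def by (rule finite_weight_le)
  obtain M where M: "\<And>w. w \<in> Q \<Longrightarrow> card (orb w) \<le> M"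
    using finite_imageI[OF finQ, of "\<lambda>w. card (orb w)"] finite_nat_set_iff_bounded_le by auto
  have "card (prods n) \<le> (card Q + 3) ^ (2 * nat \<lfloor>leaf_bound (real n + 1)\<rfloor>)
     * fact (M * nat \<lfloor>leaf_bound (real n + 1)\<rfloor> + 1)" for n
  proof -
    define L where "L = nat \<lfloor>leaf_bound (real n + 1)\<rfloor>"
    define P where "P = {t. labels t \<subseteq> Q \<and> leaves t \<le> L}"
    define A where "A = (\<lambda>t. (\<lambda>p. p \<circ> map_option (tact t)) ` {p. p permutes insert None (Some ` tpoints t)})"
    have finP: "finite P" "card P \<le> (card Q + 3) ^ (2 * L)"
      using card_portraits_le[OF finQ, of L] by (simp_all add: P_def)
    have fin_pts: "finite (insert None (Some ` tpoints t))" for t by (simp add: finite_tpoints)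
    have finA: "finite (A t)" for t
      unfolding A_def using finite_permutations[OF fin_pts] by simp
    have "prods n \<subseteq> (\<Union>t\<in>P. A t)"
    proof
      fix f assume "f \<in> prods n"
      then obtain w p where wp: "f = p \<circ> map_option (wact w)" "len w \<le> n"
        "p permutes insert None (Some ` orb w)" using prods_decompose by blast
      obtain t where t: "tact t = wact w" "orb w \<subseteq> tpoints t" "labels t \<subseteq> Q"
        "leaves t \<le> leaf_bound (weight w)"
        using ex_portrait[OF K, of w] unfolding Q_def by blast
      have "leaf_bound (weight w) \<le> leaf_bound (real n + 1)"
        using weight_bounds(2)[of w] weight_pos[of w] wp(2) alpha_bounds
        unfolding leaf_bound_def by (auto intro!: powr_mono2)
      then have "leaves t \<le> L" using t(4) unfolding L_def by (simp add: le_nat_floor)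
      then have "t \<in> P" using t by (simp add: P_def)
      moreover have "p permutes insert None (Some ` tpoints t)"
        using wp(3) t(2) by (elim permutes_subset) auto
      then have "f \<in> A t" unfolding A_def using wp(1) t(1) by auto
      ultimately show "f \<in> (\<Union>t\<in>P. A t)" by blast
    qed
    then have "card (prods n) \<le> card (\<Union>t\<in>P. A t)"
      using finP finA by (intro card_mono) auto
    also have "\<dots> \<le> (\<Sum>t\<in>P. card (A t))" by (rule card_UN_le[OF finP(1)])
    also have "\<dots> \<le> (\<Sum>t\<in>P. fact (M * L + 1))"
    proof (rule sum_mono)
      fix t assume t: "t \<in> P"
      have "card (tpoints t) \<le> M * leaves t"
        using t M by (intro card_tpoints_le) (auto simp: P_def)
      also have "\<dots> \<le> M * L" using t by (simp add: P_def)
      finally have le: "card (insert None (Some ` tpoints t)) \<le> M * L + 1"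
        by (simp add: card_insert_if finite_tpoints card_image)
      have "card (A t) \<le> card {p. p permutes insert None (Some ` tpoints t)}"
        unfolding A_def by (rule card_image_le[OF finite_permutations[OF fin_pts]])
      also have "\<dots> = fact (card (insert None (Some ` tpoints t)))"
        by (rule card_permutations[OF refl fin_pts])
      also have "\<dots> \<le> fact (M * L + 1)" by (rule fact_mono[OF le])
      finally show "card (A t) \<le> fact (M * L + 1)" .
    qed
    also have "\<dots> = card P * fact (M * L + 1)" by simp
    also have "\<dots> \<le> (card Q + 3) ^ (2 * L) * fact (M * L + 1)"
      using finP(2) by (rule mult_right_mono) simp
    finally show ?thesis unfolding L_def .
  qed
  then show ?thesis by (intro exI[of _ "card Q + 3"] exI[of _ M]) auto
qed

section \<open>Finitary permutations from star transpositions\<close>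

lemma conj_swap:
  assumes "g \<circ> g = id"
  shows "g \<circ> swap a b \<circ> g = swap (g a) (g b)"
proof
  fix y
  have "g (g z) = z" for z using fun_cong[OF assms, of z] by simp
  then show "(g \<circ> swap a b \<circ> g) y = swap (g a) (g b) y"
    by (auto simp: Transposition.transpose_def)
qed

lemma star_in_prods: "reach n \<Longrightarrow> \<exists>m. swap (Some n) None \<in> prods m"
proof (induction rule: reach.induct)
  case 1
  then show ?case using gens_prods[OF in_gens(1)] by blast
next
  case (2 n)
  then obtain m where m: "swap (Some n) None \<in> prods m" by blast
  note g = gens_prods[OF in_gens(2)]
  show ?case
    using prods_comp[OF prods_comp[OF g m] g]
    unfolding conj_swap[OF gens_involution[OF in_gens(2)]] by auto
next
  case (3 n x)
  then obtain m where m: "swap (Some n) None \<in> prods m" by blast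
  note g = gens_prods[OF in_gens(3)[of x]]
  show ?case
    using prods_comp[OF prods_comp[OF g m] g]
    unfolding conj_swap[OF gens_involution[OF in_gens(3)[of x]]] by auto
qed

lemma map_option_swap:
  assumes "a \<noteq> b"
  shows "map_option (swap a b) = swap (Some a) None \<circ> swap (Some b) None \<circ> swap (Some a) None"
proof
  fix y show "map_option (swap a b) y = (swap (Some a) None \<circ> swap (Some b) None \<circ> swap (Some a) None) y"
    using assms by (cases y) (auto simp: Transposition.transpose_def)
qed

lemma map_option_finitary_in_prods:
  assumes "bij h" "finite {x. h x \<noteq> x}"
  shows "\<exists>m. map_option h \<in> prods m"
proof -
  have "h permutes {x. h x \<noteq> x}" using assms(1) by (intro permutes_bijI) auto
  from this assms(2) show ?thesis
  proof (induction rule: permutes_induct)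
    case id
    have "map_option (id :: nat \<Rightarrow> nat) = id" by (rule option.map_id0)
    then show ?case using id_in_prods by metis
  next
    case (swap a b p)
    then obtain k where k: "map_option p \<in> prods k" by blast
    obtain i j where i: "swap (Some a) None \<in> prods i" and j: "swap (Some b) None \<in> prods j"
      using star_in_prods[OF reach_all] by blast
    show ?case
      unfolding map_option_o map_option_swap[OF \<open>a \<noteq> b\<close>]
      using prods_comp[OF prods_comp[OF prods_comp[OF i j] i] k] by blast
  qed
qed

section \<open>The group and its growth\<close>

definition full :: "(nat option \<Rightarrow> nat option) set" where
  "full = (\<Union>n. prods n)"

text \<open>The group of permutations is countable and is transported to \<open>nat\<close>, the
  carrier type required of \<open>H\<close>.\<close>

definition code :: "(nat option \<Rightarrow> nat option) \<Rightarrow> nat" where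
  "code = to_nat_on full"

definition H_group :: "nat monoid" where
  "H_group = \<lparr>carrier = code ` full,
     monoid.mult = (\<lambda>x y. code (from_nat_into full x \<circ> from_nat_into full y)),
     one = code id\<rparr>"

lemma prods_subset_full: "prods n \<subseteq> full"
  by (auto simp: full_def)

lemma gens_subset_full: "gens \<subseteq> full"
  using gens_prods prods_subset_full by blast

lemma id_in_full: "id \<in> full"
  using id_in_prods prods_subset_full by blast

lemma comp_in_full: "f \<in> full \<Longrightarrow> g \<in> full \<Longrightarrow> f \<circ> g \<in> full"
  unfolding full_def using prods_comp by blast

lemma inj_code: "inj_on code full"
  unfolding code_def full_def using finite_prods
  by (intro inj_on_to_nat_on countable_UN) (auto intro: countable_finite)

lemma decode [simp]: "f \<in> full \<Longrightarrow> from_nat_into full (code f) = f"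
  unfolding code_def full_def using finite_prods
  by (intro from_nat_into_to_nat_on countable_UN) (auto intro: countable_finite)

lemma mult_code: "f \<in> full \<Longrightarrow> g \<in> full \<Longrightarrow> code f \<otimes>\<^bsub>H_group\<^esub> code g = code (f \<circ> g)"
  by (simp add: H_group_def)

lemma carrier_H: "carrier H_group = code ` full"
  by (simp add: H_group_def)

lemma one_H: "\<one>\<^bsub>H_group\<^esub> = code id"
  by (simp add: H_group_def)

lemma group_H: "group H_group"
proof (rule groupI)
  fix x y z assume "x \<in> carrier H_group" "y \<in> carrier H_group" "z \<in> carrier H_group"
  then show "x \<otimes>\<^bsub>H_group\<^esub> y \<otimes>\<^bsub>H_group\<^esub> z = x \<otimes>\<^bsub>H_group\<^esub> (y \<otimes>\<^bsub>H_group\<^esub> z)"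
    unfolding carrier_H by (clarsimp simp only: mult_code comp_in_full o_assoc)
next
  fix x y assume "x \<in> carrier H_group" "y \<in> carrier H_group"
  then show "x \<otimes>\<^bsub>H_group\<^esub> y \<in> carrier H_group"
    unfolding carrier_H by (clarsimp simp only: mult_code comp_in_full) (blast intro: comp_in_full)
next
  show "\<one>\<^bsub>H_group\<^esub> \<in> carrier H_group" unfolding carrier_H one_H using id_in_full by (rule imageI)
next
  fix x assume "x \<in> carrier H_group"
  then show "\<one>\<^bsub>H_group\<^esub> \<otimes>\<^bsub>H_group\<^esub> x = x"
    unfolding carrier_H one_H by (clarsimp simp only: mult_code id_in_full id_o)
next
  fix x assume "x \<in> carrier H_group"
  then obtain f n where f: "x = code f" "f \<in> prods n" by (auto simp: carrier_H full_def)
  obtain g where g: "g \<in> prods n" "g \<circ> f = id" using prods_inverse[OF f(2)] by blast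
  have "code g \<otimes>\<^bsub>H_group\<^esub> x = \<one>\<^bsub>H_group\<^esub>"
    using f g prods_subset_full by (simp only: mult_code one_H subset_iff)
  then show "\<exists>y\<in>carrier H_group. y \<otimes>\<^bsub>H_group\<^esub> x = \<one>\<^bsub>H_group\<^esub>"
    using g(1) prods_subset_full unfolding carrier_H by blast
qed

lemma inv_code_gens:
  assumes "s \<in> gens"
  shows "inv\<^bsub>H_group\<^esub> (code s) = code s"
proof -
  have s: "s \<in> full" using assms gens_subset_full by blast
  have "code s \<otimes>\<^bsub>H_group\<^esub> code s = \<one>\<^bsub>H_group\<^esub>"
    unfolding mult_code[OF s s] one_H gens_involution[OF assms] ..
  then show ?thesis using group.inv_equality[OF group_H] s by (simp add: carrier_H)
qed

text \<open>The generators are involutions, so adjoining their inverses does not enlarge the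
  balls.\<close>

lemma word_ball_H: "word_ball H_group (code ` gens) n = code ` prods n"
proof (induction n)
  case 0
  show ?case by (simp only: word_ball.simps prods_0 one_H image_insert image_empty)
next
  case (Suc n)
  have "m_inv H_group ` code ` gens = code ` gens"
    unfolding image_image by (intro image_cong refl inv_code_gens)
  then have "word_ball H_group (code ` gens) (Suc n) = code ` prods n \<union>
      {x \<otimes>\<^bsub>H_group\<^esub> s | x s. x \<in> code ` prods n \<and> s \<in> code ` gens}"
    using Suc by simp
  also have "{x \<otimes>\<^bsub>H_group\<^esub> s | x s. x \<in> code ` prods n \<and> s \<in> code ` gens} =
      code ` {f \<circ> s | f s. f \<in> prods n \<and> s \<in> gens}"
  proof -
    have "code f \<otimes>\<^bsub>H_group\<^esub> code s = code (f \<circ> s)" if "f \<in> prods n" "s \<in> gens" for f s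
      using that prods_subset_full gens_subset_full by (intro mult_code) auto
    note eq = this
    show ?thesis
    proof (intro equalityI subsetI)
      fix y assume "y \<in> {x \<otimes>\<^bsub>H_group\<^esub> s | x s. x \<in> code ` prods n \<and> s \<in> code ` gens}"
      then obtain f s where "f \<in> prods n" "s \<in> gens" "y = code f \<otimes>\<^bsub>H_group\<^esub> code s" by blast
      then show "y \<in> code ` {f \<circ> s | f s. f \<in> prods n \<and> s \<in> gens}" using eq by blast
    next
      fix y assume "y \<in> code ` {f \<circ> s | f s. f \<in> prods n \<and> s \<in> gens}"
      then obtain f s where fs: "f \<in> prods n" "s \<in> gens" "y = code (f \<circ> s)" by blast
      then show "y \<in> {x \<otimes>\<^bsub>H_group\<^esub> s | x s. x \<in> code ` prods n \<and> s \<in> code ` gens}"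
        using eq[OF fs(1,2)] by (intro CollectI exI[of _ "code f"] exI[of _ "code s"]) simp
    qed
  qed
  also have "code ` prods n \<union> code ` {f \<circ> s | f s. f \<in> prods n \<and> s \<in> gens} = code ` prods (Suc n)"
    unfolding prods_Suc image_Un ..
  finally show ?case .
qed

lemma word_ball_subset_generate: "word_ball G S n \<subseteq> generate G S"
proof (induction n)
  case (Suc n)
  then show ?case by (auto intro: generate.eng generate.incl generate.inv)
qed (simp add: generate.one)

lemma generate_H: "generate H_group (code ` gens) = carrier H_group"
proof
  show "generate H_group (code ` gens) \<subseteq> carrier H_group"
    using gens_subset_full by (intro group.generate_incl[OF group_H]) (auto simp: carrier_H)
  show "carrier H_group \<subseteq> generate H_group (code ` gens)"
    using word_ball_subset_generate[of H_group "code ` gens"]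
    unfolding word_ball_H carrier_H full_def by blast
qed

lemma growth_H: "growth_fun H_group (code ` gens) n = card (prods n)"
  unfolding growth_fun_def word_ball_H
  using inj_on_subset[OF inj_code prods_subset_full] by (simp add: card_image)

text \<open>Permutations of the orbit are extended by fixing \<open>None\<close>; by
  \<open>reach_all\<close> the orbit is all of \<open>nat\<close>.\<close>

lemma FSym_embeds: "\<exists>h \<in> hom FSym H_group. inj_on h (carrier FSym)"
proof (intro bexI)
  define h where "h = (\<lambda>f :: nat \<Rightarrow> nat. code (map_option f))"
  have full: "map_option f \<in> full" if "f \<in> carrier FSym" for f
    using that map_option_finitary_in_prods[of f] by (auto simp: FSym_def full_def)
  show "h \<in> hom FSym H_group"
  proof (rule homI)
    fix f assume "f \<in> carrier FSym"
    then show "h f \<in> carrier H_group" unfolding carrier_H h_def using full by blast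
  next
    fix f g assume fg: "f \<in> carrier FSym" "g \<in> carrier FSym"
    have "f \<otimes>\<^bsub>FSym\<^esub> g = f \<circ> g" by (simp add: FSym_def)
    then show "h (f \<otimes>\<^bsub>FSym\<^esub> g) = h f \<otimes>\<^bsub>H_group\<^esub> h g"
      unfolding h_def mult_code[OF full[OF fg(1)] full[OF fg(2)]] by (simp only: map_option_o)
  qed
  show "inj_on h (carrier FSym)"
  proof (rule inj_onI)
    fix f g assume fg: "f \<in> carrier FSym" "g \<in> carrier FSym" "h f = h g"
    then have "map_option f = map_option g"
      using inj_onD[OF inj_code] full unfolding h_def by blast
    then show "f = g" by (metis ext option.inject option.simps(9))
  qed
qed

section \<open>Growth estimates\<close>

lemma growth_lower: "(\<lambda>n. exp (real n powr alpha)) \<preceq>\<^sub>g (\<lambda>n. real (card (prods n)))"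
proof -
  define b where "b = 2 / eta"
  define c where "c = (1 / eta^2) * (eta / (2 - eta))"
  have b: "2 < b" using eta_bounds by (simp add: b_def field_simps)
  have c: "0 < c" using eta_bounds by (simp add: c_def)
  \<comment> \<open>One factor \<open>b\<close> comes from rounding \<open>k\<close> up, the other
    from an extra substitution; 3 and 2 are the constants of
    \<open>card_prods_lower\<close>.\<close>
  define C where "C = nat \<lceil>3 * c * b^2 + 2\<rceil>"
  have C: "3 * c * b^2 + 2 \<le> C" unfolding C_def by linarith
  have "exp (real n powr alpha) \<le> card (prods (C * n))" if n: "1 \<le> n" for n
  proof -
    define k where "k = nat \<lceil>log b n\<rceil>"
    have log: "0 \<le> log b n" using n b by simp
    then have k: "log b n \<le> k" "k < log b n + 1" unfolding k_def by linarith+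
    have bk: "real n \<le> b ^ k" "b ^ k \<le> b * n"
    proof -
      have "real n = b powr log b n" using n b by simp
      also have "\<dots> \<le> b powr k" using k b by (intro powr_mono) auto
      finally show "real n \<le> b ^ k" using b by (simp add: powr_realpow)
      have "b ^ k = b powr k" using b by (simp add: powr_realpow)
      also have "\<dots> \<le> b powr (1 + log b n)" using k b by (intro powr_mono) auto
      also have "\<dots> = b * n" using n b by (simp add: powr_add)
      finally show "b ^ k \<le> b * n" .
    qed
    \<comment> \<open>The extra doubling pays for the change of base from e to 2, as
      \<open>ln 2\<close> is at least 1/2.\<close>
    obtain w where w: "2 ^ (k + 1) \<le> card (orb w)"
      "eta^2 * len w \<le> eta / (2 - eta) * (2 / eta) ^ (k + 1)"
      using ex_word_large_orb by blast
    have "len w \<le> c * b ^ (k + 1)"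
      using mult_left_mono[OF w(2), of "1 / eta^2"] eta_bounds by (simp add: c_def b_def)
    also have "\<dots> \<le> c * (b * (b * n))"
      using bk(2) b c by (simp add: mult_left_mono)
    finally have "3 * len w + 2 \<le> (3 * c * b^2 + 2) * n"
      using n by (simp add: algebra_simps power2_eq_square)
    also have "\<dots> \<le> real C * real n" using C by (intro mult_right_mono) auto
    finally have "3 * len w + 2 \<le> C * n" by (metis of_nat_le_iff of_nat_mult)
    then have "card (prods (3 * len w + 2)) \<le> card (prods (C * n))"
      by (intro card_mono finite_prods prods_mono)
    then have "2 ^ card (orb w) \<le> card (prods (C * n))"
      using card_prods_lower[of w] by linarith
    then have lower: "(2::real) ^ card (orb w) \<le> card (prods (C * n))"
      by (metis of_nat_le_iff of_nat_numeral of_nat_power)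
    have "real n powr alpha \<le> (b ^ k) powr alpha"
      using bk alpha_bounds by (intro powr_mono2) auto
    also have "\<dots> = (b powr alpha) ^ k"
      using b by (simp add: powr_realpow[symmetric] powr_powr mult.commute)
    also have "\<dots> = 2 ^ k" by (simp add: b_def two_over_eta_powr)
    also have "\<dots> \<le> ln 2 * 2 ^ (k + 1)"
    proof -
      have "1 / 2 \<le> ln (2::real)" using ln2_ge_two_thirds by linarith
      then have "2 ^ k * 1 \<le> (2 ^ k * (2 * ln 2) :: real)" by (intro mult_left_mono) auto
      then show ?thesis by (simp add: algebra_simps)
    qed
    also have "\<dots> \<le> ln 2 * card (orb w)"
    proof -
      have "(2::real) ^ (k + 1) \<le> card (orb w)"
        using w(1) by (metis of_nat_le_iff of_nat_numeral of_nat_power)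
      then show ?thesis by (intro mult_left_mono) auto
    qed
    finally have "exp (real n powr alpha) \<le> exp (ln 2 * card (orb w))" by simp
    also have "\<dots> = 2 ^ card (orb w)"
      by (metis exp_ln exp_of_nat2_mult mult.commute zero_less_numeral exp_of_nat_mult)
    also have "\<dots> \<le> card (prods (C * n))" by (rule lower)
    finally show ?thesis .
  qed
  moreover have "0 < C" using C c b
    by (smt (verit) of_nat_0_less_iff mult_nonneg_nonneg zero_le_power2 less_imp_le)
  ultimately show ?thesis
    unfolding growth_le_def by (intro exI[of _ C]) (auto simp: eventually_sequentially)
qed

lemma growth_upper:
  "(\<lambda>n. real (card (prods n))) \<preceq>\<^sub>g (\<lambda>n. exp (ln (real n) * real n powr alpha))"
proof -
  obtain q M where q: "q > 0" and qM: "\<And>n. card (prods n) \<le>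
      q ^ (2 * nat \<lfloor>leaf_bound (real n + 1)\<rfloor>) * fact (M * nat \<lfloor>leaf_bound (real n + 1)\<rfloor> + 1)"
    using card_prods_upper by blast
  \<comment> \<open>\<open>D\<close> bounds the number of permuted points and \<open>B\<close> the
    whole exponent, relative to \<open>n powr alpha\<close>. \<open>C\<close> is at least
    \<open>D\<close> to bound \<open>ln N\<close>, at least 3 so that the logarithm is at least 1,
    and large enough that \<open>C powr alpha\<close> absorbs \<open>B\<close>.\<close>
  define D where "D = 6 * M + 1"
  define B where "B = 12 * ln (real q) + D"
  define C where "C = max (max D 3) (nat \<lceil>B powr (1 / alpha)\<rceil>)"
  have lnq: "0 \<le> ln (real q)" using q by simp
  have B: "0 < B" using lnq by (simp add: B_def D_def add_nonneg_pos)
  have C: "D \<le> C" "3 \<le> C" "B powr (1 / alpha) \<le> C" unfolding C_def by linarith+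
  have BC: "B \<le> real C powr alpha"
  proof -
    have "B = (B powr (1 / alpha)) powr alpha" using B alpha_bounds by (simp add: powr_powr)
    also have "\<dots> \<le> real C powr alpha" using C alpha_bounds by (intro powr_mono2) auto
    finally show ?thesis .
  qed
  have "card (prods n) \<le> exp (ln (real (C * n)) * real (C * n) powr alpha)" if n: "1 \<le> n" for n
  proof -
    define L where "L = nat \<lfloor>leaf_bound (real n + 1)\<rfloor>"
    define N where "N = M * L + 1"
    define p where "p = real n powr alpha"
    have p: "1 \<le> p" "p \<le> n"
      using n alpha_bounds powr_mono[of alpha 1 "real n"] by (auto simp: p_def ge_one_powr_ge_zero)
    \<comment> \<open>The 6 arises from \<open>n + 2 \<le> 3 * n\<close>,
      \<open>3 powr alpha \<le> 3\<close> and the factor 2 in \<open>leaf_bound\<close>.\<close>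
    have L: "L \<le> 6 * p"
    proof -
      have "0 \<le> leaf_bound (real n + 1)" using leaf_bound_ge_1[of "real n + 1"] by simp
      then have "L \<le> leaf_bound (real n + 1)" unfolding L_def by (simp add: of_nat_floor)
      also have "\<dots> \<le> 2 * (3 * real n) powr alpha"
      proof -
        have "(real n + 1 + 1) powr alpha \<le> (3 * real n) powr alpha"
          using n alpha_bounds by (intro powr_mono2) auto
        then show ?thesis unfolding leaf_bound_def by simp
      qed
      also have "\<dots> = 2 * (3 powr alpha * p)" by (simp add: powr_mult p_def)
      also have "\<dots> \<le> 2 * (3 * p)"
        using p alpha_bounds powr_mono[of alpha 1 "3::real"] by (intro mult_left_mono mult_right_mono) auto
      finally show ?thesis by simp
    qed
    have Npos: "0 < real N" unfolding of_nat_0_less_iff by (simp add: N_def)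
    have N: "N \<le> D * p"
    proof -
      have "M * real L \<le> M * (6 * p)" using L by (intro mult_left_mono) auto
      then show ?thesis using p unfolding N_def D_def by (simp add: algebra_simps)
    qed
    also have "\<dots> \<le> real C * real n" using C p by (intro mult_mono) auto
    finally have "real N \<le> real (C * n)" by simp
    with Npos have lnN: "ln N \<le> ln (real (C * n))" by (intro ln_mono) auto
    have lnCn: "1 \<le> ln (real (C * n))"
    proof -
      have "3 \<le> C * n" using mult_le_mono[of 3 C 1 n] C n by simp
      then have "real 3 \<le> real (C * n)" by (rule of_nat_mono)
      then have "exp 1 \<le> real (C * n)" using exp_le by linarith
      moreover from this have "0 < real (C * n)" using exp_gt_zero[of "1::real"] by linarith
      ultimately show ?thesis using ln_ge_iff by blast
    qed
    have "card (prods n) \<le> q ^ (2 * L) * fact N" using qM[of n] unfolding L_def N_def .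
    also have "\<dots> \<le> q ^ (2 * L) * N ^ N"
      using fact_le_power[of N, where 'a = nat] by (intro mult_le_mono2) simp
    finally have "real (card (prods n)) \<le> real (q ^ (2 * L) * N ^ N)" by (rule of_nat_mono)
    also have "\<dots> = real q ^ (2 * L) * real N ^ N" by simp
    also have "\<dots> = exp (ln q) ^ (2 * L) * exp (ln N) ^ N"
      using q Npos by simp
    also have "\<dots> = exp (real (2 * L) * ln q + N * ln N)"
      by (simp only: exp_add exp_of_nat_mult)
    also have "\<dots> \<le> exp (ln (real (C * n)) * real (C * n) powr alpha)"
    proof -
      have "real (2 * L) * ln q \<le> 2 * (6 * p) * ln q * ln (real (C * n))"
      proof -
        have "real (2 * L) * ln q * 1 \<le> 2 * (6 * p) * ln q * ln (real (C * n))"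
          using L lnq lnCn p by (intro mult_mono) auto
        then show ?thesis by simp
      qed
      moreover have "N * ln N \<le> D * p * ln (real (C * n))"
        using N lnN lnCn p by (intro mult_mono) (auto simp: N_def)
      ultimately have "real (2 * L) * ln q + N * ln N \<le> ln (real (C * n)) * (B * p)"
        unfolding B_def by (simp add: algebra_simps)
      also have "\<dots> \<le> ln (real (C * n)) * (real C powr alpha * p)"
        using BC lnCn p by (intro mult_left_mono mult_right_mono) auto
      finally show ?thesis by (simp add: powr_mult p_def)
    qed
    finally show ?thesis .
  qed
  moreover have "0 < C" using C by simp
  ultimately show ?thesis
    unfolding growth_le_def by (intro exI[of _ C]) (auto simp: eventually_sequentially)
qed

lemma growth_le_trans:
  assumes "f \<preceq>\<^sub>g g" "g \<preceq>\<^sub>g h"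
  shows "f \<preceq>\<^sub>g h"
proof -
  obtain C N where C: "C > 0" "\<And>n. n \<ge> N \<Longrightarrow> f n \<le> g (C * n)"
    using assms(1) by (auto simp: growth_le_def eventually_sequentially)
  obtain C' N' where C': "C' > 0" "\<And>n. n \<ge> N' \<Longrightarrow> g n \<le> h (C' * n)"
    using assms(2) by (auto simp: growth_le_def eventually_sequentially)
  have "f n \<le> h (C' * C * n)" if "n \<ge> max N N'" for n
  proof -
    have "n \<le> C * n" using C(1) by simp
    then have "C * n \<ge> N'" using that by linarith
    from C'(2)[OF this] show ?thesis using C(2)[of n] that by (simp add: mult.assoc)
  qed
  then show ?thesis using C(1) C'(1) unfolding growth_le_def eventually_sequentially
    by (intro exI[of _ "C' * C"] conjI exI[of _ "max N N'"]) auto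
qed

text \<open>After taking logarithms, the power \<open>p\<close> outgrows every multiple of
  \<open>ln n\<close>, while \<open>ln n\<close> times that power is sublinear; rescaling the
  argument by a constant affects neither.\<close>

lemma intermediate_growthI:
  fixes p :: real
  assumes p: "0 < p" "p < 1"
    and lower: "(\<lambda>n. exp (real n powr p)) \<preceq>\<^sub>g v"
    and upper: "v \<preceq>\<^sub>g (\<lambda>n. exp (ln (real n) * real n powr p))"
  shows "intermediate_growth v"
  unfolding intermediate_growth_def
proof (intro conjI notI)
  assume "\<exists>d::nat. v \<preceq>\<^sub>g (\<lambda>n. real n ^ d)"
  then obtain d :: nat where "(\<lambda>n. exp (real n powr p)) \<preceq>\<^sub>g (\<lambda>n. real n ^ d)"
    using growth_le_trans[OF lower] by blast
  then obtain C :: nat where C: "C > 0" "\<forall>\<^sub>F n in sequentially. exp (real n powr p) \<le> real (C * n) ^ d"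
    unfolding growth_le_def by blast
  define c where "c = real C"
  define e where "e = real d"
  have ce: "c > 0" "e \<ge> 0" using C by (simp_all add: c_def e_def)
  have "((\<lambda>n::nat. e * ln (c * real n) / real n powr p) \<longlongrightarrow> 0) sequentially"
    using ce p by real_asymp
  then have "\<forall>\<^sub>F n::nat in sequentially. e * ln (c * real n) / real n powr p < 1"
    by (rule order_tendstoD) simp
  moreover note C(2)
  ultimately have "\<forall>\<^sub>F n::nat in sequentially. False"
    using eventually_gt_at_top[of 0]
  proof eventually_elim
    case (elim n)
    have "exp (real n powr p) \<le> exp (e * ln (c * real n))"
      using elim(2,3) C(1) by (simp add: e_def c_def exp_of_nat_mult)
    then show ?case using elim(1,3) by (simp add: field_simps)
  qed
  then show False by simp
next
  assume "v \<sim>\<^sub>g (\<lambda>n. exp (real n))"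
  then have "(\<lambda>n. exp (real n)) \<preceq>\<^sub>g (\<lambda>n. exp (ln (real n) * real n powr p))"
    using growth_le_trans[OF _ upper] by (simp add: growth_equiv_def)
  then obtain C :: nat where C: "C > 0"
    "\<forall>\<^sub>F n in sequentially. exp (real n) \<le> exp (ln (real (C * n)) * real (C * n) powr p)"
    unfolding growth_le_def by blast
  define c where "c = real C"
  have c: "c > 0" using C by (simp add: c_def)
  have "((\<lambda>n::nat. ln (c * real n) * (c * real n) powr p / real n) \<longlongrightarrow> 0) sequentially"
    using c p by real_asymp
  then have "\<forall>\<^sub>F n::nat in sequentially. ln (c * real n) * (c * real n) powr p / real n < 1"
    by (rule order_tendstoD) simp
  moreover note C(2)
  ultimately have "\<forall>\<^sub>F n::nat in sequentially. False"
    using eventually_gt_at_top[of 0]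
  proof eventually_elim
    case (elim n)
    then show ?case by (simp add: field_simps c_def)
  qed
  then show False by simp
qed

theorem theorem6p1:
  "\<exists>(H :: nat monoid) S.
     group H \<and> finite S \<and> S \<subseteq> carrier H \<and> generate H S = carrier H \<and>
     intermediate_growth (growth_fun H S) \<and>
     (\<exists>h \<in> hom FSym H. inj_on h (carrier FSym)) \<and>
     (\<lambda>n. exp (real n powr alpha)) \<preceq>\<^sub>g growth_fun H S \<and>
     growth_fun H S \<preceq>\<^sub>g (\<lambda>n. exp (ln (real n) * real n powr alpha))"
proof -
  have growth: "growth_fun H_group (code ` gens) = (\<lambda>n. real (card (prods n)))"
    using growth_H by blast
  have "code ` gens \<subseteq> carrier H_group"
    unfolding carrier_H using gens_subset_full by blast
  moreover have "intermediate_growth (growth_fun H_group (code ` gens))"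
    unfolding growth using alpha_bounds growth_lower growth_upper by (rule intermediate_growthI)
  ultimately show ?thesis
    using group_H finite_imageI[OF finite_gens] generate_H FSym_embeds growth_lower growth_upper
    unfolding growth[symmetric] by blast
qed

end
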